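(* Suppose $\Theta\subseteq S^1$ is a closed set with positive one-dimensional measure. Then $\Theta$ is good.
   Context: One-dimensional measure is arc-length (Lebesgue) measure on the unit circle $S^1$, which is identified with the set of angles (mod $2\pi$). A lattice in $\mathbb{R}^2$ is a discrete subgroup of rank 2. $B_\epsilon(0)=\{x\in\mathbb{R}^2:|x|<\epsilon\}$. $R_\theta$ denotes rotation of $\mathbb{R}^2$ about the origin by the angle $\theta$, and $R_\Theta E = \{R_\theta x: \theta\in\Theta, x\in E\}$. A set $\Theta\subseteq S^1$ is called $(\Lambda,\epsilon)$-good if $R_\Theta E$ contains the complement of a disk, where $E=\Lambda+B_\epsilon(0)$; it is called good if it is $(\Lambda,\epsilon)$-good for all lattices $\Lambda\subseteq\mathbb{R}^2$ and all $\epsilon>0$. *)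

theory Defs
  imports "HOL-Analysis.Analysis"
begin

text \<open>
  The unit circle is the sphere of radius one in the plane; the angle \<open>t\<close> (mod \<open>2\<pi>\<close>)
  is identified with the point \<open>circle_point t\<close>.
\<close>

definition circle_point :: "real \<Rightarrow> real^2" where
  "circle_point t = vector [cos t, sin t]"

abbreviation unit_circle :: "(real^2) set" where
  "unit_circle \<equiv> sphere 0 1"

text \<open>
  Arc length is the image of Lebesgue measure on \<open>[0, 2\<pi>)\<close>, of total mass \<open>2\<pi>\<close>.
  It is regarded as a Borel measure on the whole plane, concentrated on the circle.
\<close>

definition arc_length_measure :: "(real^2) measure" where
  "arc_length_measure = distr (restrict_space lborel {0..<2*pi}) borel circle_point"

definition rotation :: "real \<Rightarrow> real^2^2" where
  "rotation t = vector [vector [cos t, - sin t], vector [sin t, cos t]]"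

definition rotate_set :: "(real^2) set \<Rightarrow> (real^2) set \<Rightarrow> (real^2) set" where
  "rotate_set \<Theta> E = {rotation t *v x | t x. circle_point t \<in> \<Theta> \<and> x \<in> E}"

definition additive_subgroup :: "'a::group_add set \<Rightarrow> bool" where
  "additive_subgroup L \<longleftrightarrow> 0 \<in> L \<and> (\<forall>x\<in>L. \<forall>y\<in>L. x + y \<in> L) \<and> (\<forall>x\<in>L. - x \<in> L)"

text \<open>
  The rank is that of an abelian group: the largest number of elements that are linearly
  independent over the integers (not over the reals).
\<close>

abbreviation int_scale :: "int \<Rightarrow> 'a::real_vector \<Rightarrow> 'a" where
  "int_scale \<equiv> \<lambda>n x. of_int n *\<^sub>R x"

lemma module_int_scale: "module (int_scale :: int \<Rightarrow> 'a::real_vector \<Rightarrow> 'a)"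
  by unfold_locales (simp_all add: algebra_simps)

definition int_independent :: "'a::real_vector set \<Rightarrow> bool" where
  "int_independent B \<longleftrightarrow> \<not> module.dependent int_scale B"

definition has_rank :: "'a::real_vector set \<Rightarrow> nat \<Rightarrow> bool" where
  "has_rank L n \<longleftrightarrow>
     (\<exists>B\<subseteq>L. int_independent B \<and> finite B \<and> card B = n) \<and>
     (\<forall>B\<subseteq>L. int_independent B \<longrightarrow> finite B \<and> card B \<le> n)"

definition is_lattice :: "(real^2) set \<Rightarrow> bool" where
  "is_lattice \<Lambda> \<longleftrightarrow> additive_subgroup \<Lambda> \<and> discrete \<Lambda> \<and> has_rank \<Lambda> 2"

definition fattened :: "(real^2) set \<Rightarrow> real \<Rightarrow> (real^2) set" where
  "fattened \<Lambda> \<epsilon> = {l + b | l b. l \<in> \<Lambda> \<and> b \<in> ball 0 \<epsilon>}"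

definition good_for :: "(real^2) set \<Rightarrow> real \<Rightarrow> (real^2) set \<Rightarrow> bool" where
  "good_for \<Lambda> \<epsilon> \<Theta> \<longleftrightarrow> (\<exists>c r. r > 0 \<and> - ball c r \<subseteq> rotate_set \<Theta> (fattened \<Lambda> \<epsilon>))"

definition good :: "(real^2) set \<Rightarrow> bool" where
  "good \<Theta> \<longleftrightarrow> (\<forall>\<Lambda> \<epsilon>. is_lattice \<Lambda> \<longrightarrow> \<epsilon> > 0 \<longrightarrow> good_for \<Lambda> \<epsilon> \<Theta>)"

end

(* Weyl equidistribution: the points R_{-t} x with t in \<Theta> become equidistributed modulo
   the lattice as |x| tends to infinity. The characters of the torus become oscillatory integrals
   of cis (A cos t + B sin t) over \<Theta>, with A^2 + B^2 proportional to |x|^2; these tend to 0.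
   Test against (cos (pi a) cos (pi b))^(2N), with a, b the coordinates in a basis of the lattice.
   Its mean on the torus decays only like 1/N, whereas away from the lattice points it is at most
   q^N with q < 1. So for large N and |x| some R_{-t} x must lie close to a lattice point. *)

theory Submission
  imports Defs
begin

text \<open>\<open>\<Theta>\<close> may be Cantor-like and contain no arc, so integration by parts
  over the angle set itself is impossible; its indicator is first replaced by a polynomial close to
  it in L^1. The second obstacle is uniformity in direction: covering the complement of a disk needs
  a bound that depends on |x| alone, while the stationary points of A cos t + B sin t move with the
  direction of x. Writing the phase as T cos(t - \<psi>) with T^2 = A^2 + B^2 separates size from
  direction. For fixed N the test function is a trigonometric polynomial, so only finitely many
  characters occur and their limits can simply be added. The measure of the angle set multiplies
  both sides of the final comparison and cancels, so any positive value will do.\<close>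

section \<open>Decay of oscillatory integrals, uniform in the direction of (A, B)\<close>

text \<open>Controls the part of the oscillatory integral near stationary points. A unit vector
  (\<alpha>, \<beta>) only shifts the argument of the cosine, so one dominated convergence, for the
  unshifted function on a longer interval, serves all directions. The integrand tends to 0 off the
  countable zero set of cos.\<close>

lemma integral_damped_cos_small:
  fixes a b \<delta> :: real
  assumes "\<delta> > 0"
  shows "\<exists>\<kappa>>0. \<forall>\<alpha> \<beta>. \<alpha>\<^sup>2 + \<beta>\<^sup>2 = 1 \<longrightarrow>
    (LINT t:{a..b}|lborel. \<kappa> / ((\<alpha> * cos t + \<beta> * sin t)\<^sup>2 + \<kappa>)) \<le> \<delta>"
proof -
  define F where "F \<kappa> t = \<kappa> / ((cos t)\<^sup>2 + \<kappa>)" for \<kappa> t :: real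
  define I where "I = {a - 2 * pi..b}"
  have F_cont: "continuous_on X (F \<kappa>)" if "\<kappa> > 0" for \<kappa> X
    using that unfolding F_def
    by (intro continuous_intros) (metis add_nonneg_pos less_irrefl zero_le_power2)
  have F_bounds: "0 \<le> F \<kappa> t" "F \<kappa> t \<le> 1" if "\<kappa> > 0" for \<kappa> t
    using that unfolding F_def by (auto simp: divide_simps add_nonneg_pos)
  have F_meas: "F \<kappa> \<in> borel_measurable borel" for \<kappa>
    unfolding F_def by measurable
  have "(\<lambda>n. LINT t|lborel. indicator I t *\<^sub>R F (1 / real (Suc n)) t) \<longlonglongrightarrow> (LINT t|(lborel :: real measure). (0::real))"
  proof (rule integral_dominated_convergence[where w = "indicator I"])
    show "(\<lambda>t. indicator I t *\<^sub>R F (1 / real (Suc n)) t) \<in> borel_measurable lborel" for n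
      using F_meas by (auto simp: I_def)
    show "integrable lborel (indicator I :: real \<Rightarrow> real)"
      by (simp add: I_def integrable_indicator_iff emeasure_lborel_Icc_eq)
    show "AE t in lborel. norm (indicator I t *\<^sub>R F (1 / real (Suc n)) t) \<le> indicator I t" for n
      using F_bounds[of "1 / real (Suc n)"] by (auto simp: indicator_def)
    have "{t::real. cos t = 0} \<subseteq> range (\<lambda>i::int. of_int i * (pi / 2))"
      by (auto simp: cos_zero_iff_int)
    then have "countable {t::real. cos t = 0}"
      by (rule countable_subset) simp
    then have "AE t in lborel. (t::real) \<notin> {t. cos t = 0}"
      by (intro AE_not_in countable_imp_null_set_lborel)
    then show "AE t in lborel. (\<lambda>n. indicator I t *\<^sub>R F (1 / real (Suc n)) t) \<longlonglongrightarrow> 0"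
    proof eventually_elim
      case (elim t)
      have "(\<lambda>n. F (1 / real (Suc n)) t) \<longlonglongrightarrow> 0 / ((cos t)\<^sup>2 + 0)"
        unfolding F_def using elim
        by (intro tendsto_intros LIMSEQ_Suc[OF lim_1_over_n]) auto
      then show ?case
        by (intro tendsto_eq_intros) auto
    qed
  qed simp_all
  then have "(\<lambda>n. LINT t:I|lborel. F (1 / real (Suc n)) t) \<longlonglongrightarrow> 0"
    by (simp add: set_lebesgue_integral_def)
  from order_tendstoD(2)[OF this \<open>\<delta> > 0\<close>] obtain n where
    n: "(LINT t:I|lborel. F (1 / real (Suc n)) t) < \<delta>"
    by (auto simp: eventually_sequentially)
  define \<kappa> where "\<kappa> = 1 / real (Suc n)"
  have "\<kappa> > 0" by (simp add: \<kappa>_def)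
  have "(LINT t:{a..b}|lborel. \<kappa> / ((\<alpha> * cos t + \<beta> * sin t)\<^sup>2 + \<kappa>)) \<le> \<delta>"
    if "\<alpha>\<^sup>2 + \<beta>\<^sup>2 = 1" for \<alpha> \<beta> :: real
  proof -
    obtain \<psi> where \<psi>: "0 \<le> \<psi>" "\<psi> < 2 * pi" "\<alpha> = cos \<psi>" "\<beta> = sin \<psi>"
      using sincos_total_2pi[OF \<open>\<alpha>\<^sup>2 + \<beta>\<^sup>2 = 1\<close>] .
    have "\<kappa> / ((\<alpha> * cos t + \<beta> * sin t)\<^sup>2 + \<kappa>) = F \<kappa> (t - \<psi>)" for t
      by (simp add: F_def cos_diff \<psi> mult.commute)
    then have "(LINT t:{a..b}|lborel. \<kappa> / ((\<alpha> * cos t + \<beta> * sin t)\<^sup>2 + \<kappa>))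
        = (LINT t|lborel. indicator {a..b} t *\<^sub>R F \<kappa> (t - \<psi>))"
      by (simp add: set_lebesgue_integral_def)
    also have "\<dots> = (LINT t|lborel. indicator {a..b} (\<psi> + 1 * t) *\<^sub>R F \<kappa> (\<psi> + 1 * t - \<psi>))"
      by (subst lborel_integral_real_affine[where c = 1 and t = \<psi>]) auto
    also have "\<dots> \<le> (LINT t|lborel. indicator I t *\<^sub>R F \<kappa> t)"
    proof (rule integral_mono)
      have "set_integrable lborel I (F \<kappa>)"
        unfolding I_def by (intro borel_integrable_atLeastAtMost' F_cont \<open>\<kappa> > 0\<close>)
      then show "integrable lborel (\<lambda>t. indicator I t *\<^sub>R F \<kappa> t)"
        by (simp add: set_integrable_def)
      have "set_integrable lborel {a - \<psi>..b - \<psi>} (F \<kappa>)"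
        by (intro borel_integrable_atLeastAtMost' F_cont \<open>\<kappa> > 0\<close>)
      moreover have "(indicator {a..b} (\<psi> + t) :: real) = indicator {a - \<psi>..b - \<psi>} t" for t
        by (auto simp: indicator_def)
      ultimately show "integrable lborel (\<lambda>t. indicator {a..b} (\<psi> + 1 * t) *\<^sub>R F \<kappa> (\<psi> + 1 * t - \<psi>))"
        by (simp add: set_integrable_def)
      show "indicator {a..b} (\<psi> + 1 * t) *\<^sub>R F \<kappa> (\<psi> + 1 * t - \<psi>) \<le> indicator I t *\<^sub>R F \<kappa> t" for t
        using \<psi> F_bounds(1)[OF \<open>\<kappa> > 0\<close>, of t] by (auto simp: indicator_def I_def)
    qed
    also have "\<dots> \<le> \<delta>"
      using n by (simp add: set_lebesgue_integral_def \<kappa>_def)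
    finally show ?thesis .
  qed
  with \<open>\<kappa> > 0\<close> show ?thesis by blast
qed

text \<open>The order of choices matters: \<kappa> is fixed first, from \<delta> and the amplitude
  alone, so that the non-oscillating remainder is at most \<delta>/2 for every phase; only then is M
  taken so large that the boundary and derivative terms, of size C/T, are at most \<delta>/2 as
  well.\<close>

lemma oscillatory_integral_smooth:
  fixes p p' :: "real \<Rightarrow> real" and a b \<delta> :: real
  assumes "a \<le> b" "\<delta> > 0"
    and p: "\<And>t. (p has_real_derivative p' t) (at t)" and p': "continuous_on UNIV p'"
  shows "\<exists>M>0. \<forall>A B. A\<^sup>2 + B\<^sup>2 \<ge> M\<^sup>2 \<longrightarrow>
    norm (LINT t:{a..b}|lborel. p t *\<^sub>R cis (A * cos t + B * sin t)) \<le> \<delta>"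
proof -
  have p_cont: "continuous_on UNIV p"
    using p by (meson DERIV_continuous continuous_at_imp_continuous_on)
  have bdd: "bounded (h ` {a..b})" if "continuous_on UNIV h" for h :: "real \<Rightarrow> real"
    using that by (meson compact_Icc compact_continuous_image compact_imp_bounded
      continuous_on_subset subset_UNIV)
  obtain P1 P2 where P12: "\<And>t. t \<in> {a..b} \<Longrightarrow> \<bar>p t\<bar> \<le> P1" "\<And>t. t \<in> {a..b} \<Longrightarrow> \<bar>p' t\<bar> \<le> P2"
    using bdd[OF p_cont] bdd[OF p'] unfolding bounded_iff by fastforce
  \<comment> \<open>The 1 keeps P positive, so that \<delta> / (2 P) is a legitimate tolerance even
    for p = 0.\<close>
  define P where "P = max 1 (max P1 P2)"
  have P: "P > 0" "\<And>t. t \<in> {a..b} \<Longrightarrow> \<bar>p t\<bar> \<le> P" "\<And>t. t \<in> {a..b} \<Longrightarrow> \<bar>p' t\<bar> \<le> P"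
    using P12 by (fastforce simp: P_def)+
  obtain \<kappa> where \<kappa>: "\<kappa> > 0"
    and rem: "\<And>\<alpha> \<beta>. \<alpha>\<^sup>2 + \<beta>\<^sup>2 = 1 \<Longrightarrow>
      (LINT t:{a..b}|lborel. \<kappa> / ((\<alpha> * cos t + \<beta> * sin t)\<^sup>2 + \<kappa>)) \<le> \<delta> / (2 * P)"
    using integral_damped_cos_small[of "\<delta> / (2 * P)" a b] \<open>\<delta> > 0\<close> P(1) by auto
  \<comment> \<open>First summand: two boundary terms, each at most P / (\<kappa> T). Second
    summand: the integral of \<open>q\<close>, which is bounded by 2 P / (\<kappa> T). The factor
    1/T is split off.\<close>
  define C where "C = 2 * P / \<kappa> + (b - a) * (2 * P / \<kappa>)"
  have "C > 0" using P(1) \<kappa> \<open>a \<le> b\<close> by (simp add: C_def add_pos_nonneg)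
  define M where "M = 2 * C / \<delta>"
  have "M > 0" using \<open>C > 0\<close> \<open>\<delta> > 0\<close> by (simp add: M_def)
  have "norm (LINT t:{a..b}|lborel. p t *\<^sub>R cis (A * cos t + B * sin t)) \<le> \<delta>"
    if AB: "A\<^sup>2 + B\<^sup>2 \<ge> M\<^sup>2" for A B
  proof -
    define T where "T = sqrt (A\<^sup>2 + B\<^sup>2)"
    have T: "T \<ge> M" "T > 0" "A\<^sup>2 + B\<^sup>2 = T\<^sup>2"
      using AB \<open>M > 0\<close> real_le_rsqrt[OF AB]
      by (auto simp: T_def intro: less_le_trans[OF zero_less_power])
    define f where "f t = A * cos t + B * sin t" for t
    \<comment> \<open>Split 1 as f1^2 / D + \<kappa> T^2 / D: the first part can be integrated by parts uniformly in the
      phase, since D stays away from 0 at the stationary points; the second has small integral.\<close>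
    define f1 where "f1 t = B * cos t - A * sin t" for t
    define D where "D t = (f1 t)\<^sup>2 + \<kappa> * T\<^sup>2" for t
    define g where "g t = f1 t / D t" for t
    define g1 where "g1 t = f t * ((f1 t)\<^sup>2 - \<kappa> * T\<^sup>2) / (D t)\<^sup>2" for t
    define q where "q t = p' t * g t + p t * g1 t" for t
    have kT: "\<kappa> * T\<^sup>2 > 0" using \<kappa> T(2) by simp
    then have D: "D t > 0" "D t \<ge> \<kappa> * T\<^sup>2" "D t \<noteq> 0" for t
      unfolding D_def by (auto simp: add_nonneg_pos add_nonneg_eq_0_iff)
    \<comment> \<open>Since \<open>f1\<close> is the derivative of \<open>f\<close> and
      -\<open>f\<close> that of \<open>f1\<close>, this identity bounds the phase and all its
      derivatives by T.\<close>
    have ff: "(f t)\<^sup>2 + (f1 t)\<^sup>2 = T\<^sup>2" for t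
    proof -
      have "(f t)\<^sup>2 + (f1 t)\<^sup>2 = (A\<^sup>2 + B\<^sup>2) * ((sin t)\<^sup>2 + (cos t)\<^sup>2)"
        unfolding f_def f1_def by algebra
      then show ?thesis by (simp add: T)
    qed
    have f_le: "\<bar>f t\<bar> \<le> T" "\<bar>f1 t\<bar> \<le> T" for t
    proof -
      have "(f t)\<^sup>2 \<le> T\<^sup>2" "(f1 t)\<^sup>2 \<le> T\<^sup>2"
        using ff[of t] zero_le_power2[of "f t"] zero_le_power2[of "f1 t"] by linarith+
      then show "\<bar>f t\<bar> \<le> T" "\<bar>f1 t\<bar> \<le> T"
        using T(2) by (simp_all flip: abs_le_square_iff)
    qed
    have f': "(f has_real_derivative f1 t) (at t)" for t
      unfolding f_def f1_def by (auto intro!: derivative_eq_intros)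
    have f1': "(f1 has_real_derivative - f t) (at t)" for t
      unfolding f_def f1_def by (auto intro!: derivative_eq_intros)
    have g': "(g has_real_derivative g1 t) (at t)" for t
    proof -
      have "(g has_real_derivative
          (- f t * D t - f1 t * (2 * f1 t * - f t)) / (D t * D t)) (at t)"
        unfolding g_def D_def using D(3)[of t] 
        by (auto intro!: derivative_eq_intros f1' simp: D_def)
      moreover have "(- f t * D t - f1 t * (2 * f1 t * - f t)) / (D t * D t) = g1 t"
        by (simp add: g1_def D_def power2_eq_square algebra_simps)
      ultimately show ?thesis by simp
    qed
    have cT: "T / (\<kappa> * T\<^sup>2) = 1 / (\<kappa> * T)"
      using T by (simp add: power2_eq_square)
    have g_le: "\<bar>g t\<bar> \<le> 1 / (\<kappa> * T)" for t
    proof -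
      have "\<bar>g t\<bar> = \<bar>f1 t\<bar> / D t" using D(1)[of t] by (simp add: g_def)
      also have "\<dots> \<le> T / (\<kappa> * T\<^sup>2)"
        using f_le D(2)[of t] kT T by (intro frac_le) auto
      finally show ?thesis using cT by simp
    qed
    \<comment> \<open>One factor 1/D is paired with \<open>f\<close>, as in the bound for
      \<open>g\<close>. The other is absorbed: D is the sum of the two nonnegative terms whose
      difference stands in the numerator.\<close>
    have g1_le: "\<bar>g1 t\<bar> \<le> 1 / (\<kappa> * T)" for t
    proof -
      have "\<bar>g1 t\<bar> = \<bar>f t\<bar> / D t * (\<bar>(f1 t)\<^sup>2 - \<kappa> * T\<^sup>2\<bar> / D t)"
        using D(1)[of t] by (simp add: g1_def abs_mult power2_eq_square)
      also have "\<dots> \<le> T / (\<kappa> * T\<^sup>2) * 1"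
      proof (rule mult_mono)
        show "\<bar>f t\<bar> / D t \<le> T / (\<kappa> * T\<^sup>2)"
          using f_le D(2)[of t] kT T by (intro frac_le) auto
        have "\<bar>(f1 t)\<^sup>2 - \<kappa> * T\<^sup>2\<bar> \<le> D t"
          using kT unfolding D_def by (auto simp: abs_le_iff)
        then show "\<bar>(f1 t)\<^sup>2 - \<kappa> * T\<^sup>2\<bar> / D t \<le> 1"
          using D(1)[of t] by simp
      qed (use T kT D(1)[of t] in auto)
      finally show ?thesis using cT by simp
    qed
    have q_le: "\<bar>q t\<bar> \<le> 2 * P / (\<kappa> * T)" if "t \<in> {a..b}" for t
    proof -
      have "\<bar>q t\<bar> \<le> \<bar>p' t\<bar> * \<bar>g t\<bar> + \<bar>p t\<bar> * \<bar>g1 t\<bar>"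
        unfolding q_def by (metis abs_mult abs_triangle_ineq)
      also have "\<dots> \<le> P * (1 / (\<kappa> * T)) + P * (1 / (\<kappa> * T))"
        using P that g_le g1_le by (intro add_mono mult_mono) auto
      finally show ?thesis by (simp add: mult.commute)
    qed
    define e where "e t = cis (f t)" for t
    \<comment> \<open>\<open>- \<i> * e t\<close> has derivative \<open>f1 t * e t\<close>, so
      differentiating G yields the first piece p g f1 e of the split together with an error carrying
      \<open>q\<close>, the derivative of p g.\<close>
    define G where "G t = complex_of_real (p t * g t) * (- \<i> * e t)" for t
    define G' where "G' t = complex_of_real (p t * g t * f1 t) * e t
      + complex_of_real (q t) * (- \<i> * e t)" for t
    define r where "r t = complex_of_real (p t * (\<kappa> * T\<^sup>2 / D t)) * e t" for t
    have e': "(e has_vector_derivative \<i> * f1 t * e t) (at t within X)" for t X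
    proof -
      have "((\<lambda>t. complex_of_real (f t)) has_vector_derivative complex_of_real (f1 t)) (at t within X)"
        using f'[of t] has_real_derivative_iff_has_vector_derivative has_vector_derivative_at_within
          has_vector_derivative_of_real by blast
      from field_vector_diff_chain_within[OF has_vector_derivative_mult_right[OF this, of \<i>]
          has_field_derivative_at_within[OF DERIV_exp]]
      have "((\<lambda>t. exp (\<i> * complex_of_real (f t))) has_vector_derivative
        \<i> * of_real (f1 t) * exp (\<i> * complex_of_real (f t))) (at t within X)"
        by (simp add: o_def)
      then show ?thesis
        by (simp add: e_def[abs_def] cis_conv_exp mult_ac)
    qed
    have cont: "continuous_on X p'" "continuous_on X p" "continuous_on X g" "continuous_on X f"
      "continuous_on X f1" "continuous_on X D" for X
      using p' p_cont D(3) unfolding g_def D_def f1_def f_def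
      by (auto intro!: continuous_intros intro: continuous_on_subset)
    have cont_q: "continuous_on X q" and cont_e: "continuous_on X e" for X
      using cont[of X] D(3) unfolding q_def g1_def e_def by (auto intro!: continuous_intros)
    have G_deriv: "(G has_vector_derivative G' t) (at t within {a..b})" for t
    proof -
      have "((\<lambda>t. p t * g t) has_real_derivative q t) (at t within {a..b})"
        unfolding q_def using has_field_derivative_at_within[OF DERIV_mult[OF p g']]
        by (simp add: mult.commute)
      then have "((\<lambda>t. complex_of_real (p t * g t)) has_vector_derivative complex_of_real (q t)) (at t within {a..b})"
        using has_real_derivative_iff_has_vector_derivative has_vector_derivative_of_real by blast
      from has_vector_derivative_mult[OF this has_vector_derivative_mult_right[OF e', of "- \<i>"]]
      show ?thesis
        unfolding G_def G'_def by (rule back_subst[where P = "\<lambda>x. (_ has_vector_derivative x) _"])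
          (simp add: algebra_simps)
    qed
    have G'_cont: "continuous_on {a..b} G'"
      unfolding G'_def using cont[of "{a..b}"] cont_q[of "{a..b}"] cont_e[of "{a..b}"]
      by (intro continuous_intros)
    have split: "p t *\<^sub>R e t = G' t + r t - complex_of_real (q t) * (- \<i> * e t)" for t
    proof -
      have "g t * f1 t + \<kappa> * T\<^sup>2 / D t = 1"
        using D(3)[of t] by (simp add: g_def D_def power2_eq_square flip: add_divide_distrib)
      then have "p t = p t * g t * f1 t + p t * (\<kappa> * T\<^sup>2 / D t)"
        by algebra
      then have "complex_of_real (p t) = complex_of_real (p t * g t * f1 t) + complex_of_real (p t * (\<kappa> * T\<^sup>2 / D t))"
        by (metis of_real_add)
      then have "p t *\<^sub>R e t = complex_of_real (p t * g t * f1 t) * e t + complex_of_real (p t * (\<kappa> * T\<^sup>2 / D t)) * e t"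
        by (simp add: scaleR_conv_of_real distrib_right del: of_real_mult of_real_add)
      then show ?thesis
        unfolding G'_def r_def by simp
    qed
    have int_r: "set_integrable lborel {a..b} r"
      unfolding r_def using cont[of "{a..b}"] cont_e[of "{a..b}"] D(3)
      by (intro borel_integrable_atLeastAtMost' continuous_intros) auto
    have int_q: "set_integrable lborel {a..b} (\<lambda>t. complex_of_real (q t) * (- \<i> * e t))"
      using cont_q[of "{a..b}"] cont_e[of "{a..b}"]
      by (intro borel_integrable_atLeastAtMost' continuous_intros) auto
    have int_G: "set_integrable lborel {a..b} G'"
      by (intro borel_integrable_atLeastAtMost' G'_cont)
    have norm_e: "norm (e t) = 1" for t by (simp add: e_def)
    have "(LINT t:{a..b}|lborel. p t *\<^sub>R e t) = (LINT t:{a..b}|lborel. G' t) + (LINT t:{a..b}|lborel. r t)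
        - (LINT t:{a..b}|lborel. complex_of_real (q t) * (- \<i> * e t))"
      unfolding split using int_r int_q int_G
      by (subst set_integral_diff set_integral_add; (intro set_integral_add)?; simp)+
    also have "(LINT t:{a..b}|lborel. G' t) = G b - G a"
      unfolding set_lebesgue_integral_def
      by (intro integral_FTC_Icc \<open>a \<le> b\<close> G_deriv G'_cont)
    moreover have "norm (w - x + y - z) \<le> norm w + norm x + norm y + norm z" for w x y z :: complex
      by norm
    ultimately have "norm (LINT t:{a..b}|lborel. p t *\<^sub>R e t)
        \<le> norm (G b) + norm (G a) + norm (LINT t:{a..b}|lborel. r t)
        + norm (LINT t:{a..b}|lborel. complex_of_real (q t) * (- \<i> * e t))"
      by simp
    moreover have "norm (G t) \<le> P / (\<kappa> * T)" if "t \<in> {a..b}" for t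
    proof -
      have "norm (G t) = \<bar>p t\<bar> * \<bar>g t\<bar>"
        by (simp add: G_def norm_mult norm_e abs_mult)
      also have "\<dots> \<le> P * (1 / (\<kappa> * T))"
        using P that g_le by (intro mult_mono) auto
      finally show ?thesis by simp
    qed
    then have "norm (G b) \<le> P / (\<kappa> * T)" "norm (G a) \<le> P / (\<kappa> * T)"
      using \<open>a \<le> b\<close> by auto
    moreover have "norm (LINT t:{a..b}|lborel. complex_of_real (q t) * (- \<i> * e t))
        \<le> (b - a) * (2 * P / (\<kappa> * T))"
    proof -
      have "norm (LINT t:{a..b}|lborel. complex_of_real (q t) * (- \<i> * e t))
          \<le> (LINT t:{a..b}|lborel. norm (complex_of_real (q t) * (- \<i> * e t)))"
        by (rule set_integral_norm_bound[OF int_q])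
      also have "\<dots> \<le> (LINT t:{a..b}|lborel. 2 * P / (\<kappa> * T))"
        using q_le int_q cont_q cont_e by (intro set_integral_mono borel_integrable_atLeastAtMost' continuous_intros
            set_integrable_norm) (auto simp: norm_mult norm_e)
      also have "\<dots> = (b - a) * (2 * P / (\<kappa> * T))"
        using \<open>a \<le> b\<close> by (simp add: set_integral_const)
      finally show ?thesis .
    qed
    moreover have "norm (LINT t:{a..b}|lborel. r t) \<le> \<delta> / 2"
    proof -
      \<comment> \<open>Dividing by T^2 normalises the direction to the unit vector (B/T, -A/T); T
        disappears and the choice of \<kappa> applies.\<close>
      have r_eq: "\<kappa> * T\<^sup>2 / D t = \<kappa> / ((B / T * cos t + (- A / T) * sin t)\<^sup>2 + \<kappa>)" for t
      proof -
        have "B / T * cos t + (- A / T) * sin t = f1 t / T"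
          using T by (simp add: f1_def field_simps)
        then have "\<kappa> / ((B / T * cos t + (- A / T) * sin t)\<^sup>2 + \<kappa>) = \<kappa> / (D t / T\<^sup>2)"
          using T by (simp add: D_def power_divide add_divide_distrib)
        then show ?thesis by simp
      qed
      have int_k: "set_integrable lborel {a..b} (\<lambda>t. P * (\<kappa> * T\<^sup>2 / D t))"
        using cont[of "{a..b}"] D(3) by (intro borel_integrable_atLeastAtMost' continuous_intros) auto
      have "norm (LINT t:{a..b}|lborel. r t) \<le> (LINT t:{a..b}|lborel. norm (r t))"
        by (rule set_integral_norm_bound[OF int_r])
      also have "\<dots> \<le> (LINT t:{a..b}|lborel. P * (\<kappa> * T\<^sup>2 / D t))"
      proof (intro set_integral_mono set_integrable_norm int_r int_k)
        fix t assume "t \<in> {a..b}"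
        have "norm (r t) = \<bar>p t\<bar> * (\<kappa> * T\<^sup>2 / D t)"
          unfolding r_def norm_mult norm_of_real norm_e
          using \<kappa> D(1)[of t] by (simp add: abs_mult)
        also have "\<dots> \<le> P * (\<kappa> * T\<^sup>2 / D t)"
          using P(2)[OF \<open>t \<in> {a..b}\<close>] kT D(1)[of t] by (intro mult_right_mono) auto
        finally show "norm (r t) \<le> P * (\<kappa> * T\<^sup>2 / D t)" .
      qed
      also have "\<dots> = P * (LINT t:{a..b}|lborel. \<kappa> / ((B / T * cos t + (- A / T) * sin t)\<^sup>2 + \<kappa>))"
        unfolding r_eq by (rule set_integral_mult_right)
      also have "\<dots> \<le> P * (\<delta> / (2 * P))"
      proof (intro mult_left_mono rem)
        have "(B / T)\<^sup>2 + (- A / T)\<^sup>2 = (A\<^sup>2 + B\<^sup>2) / T\<^sup>2"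
          by (simp add: power_divide add_divide_distrib)
        then show "(B / T)\<^sup>2 + (- A / T)\<^sup>2 = 1" using T by simp
      qed (use P in simp)
      finally show ?thesis using P(1) by simp
    qed
    ultimately have "norm (LINT t:{a..b}|lborel. p t *\<^sub>R e t) \<le> P / (\<kappa> * T) + P / (\<kappa> * T) + (b - a) * (2 * P / (\<kappa> * T)) + \<delta> / 2"
      by linarith
    also have "P / (\<kappa> * T) + P / (\<kappa> * T) + (b - a) * (2 * P / (\<kappa> * T)) = C / T"
      using T \<kappa> by (simp add: C_def field_simps)
    also have "C / T \<le> C / M"
      using T \<open>C > 0\<close> \<open>M > 0\<close> by (intro divide_left_mono) auto
    also have "C / M = \<delta> / 2"
      using \<open>C > 0\<close> \<open>\<delta> > 0\<close> by (simp add: M_def)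
    finally show ?thesis by (simp add: e_def f_def)
  qed
  with \<open>M > 0\<close> show ?thesis by blast
qed

text \<open>Two approximations: the continuous functions 1 / (1 + n dist(t, S)) converge pointwise
  to the indicator because S is closed, and Stone-Weierstrass turns one of them into a polynomial,
  which supplies the continuously differentiable amplitude for the integration by parts.\<close>

lemma indicator_L1_approx_polynomial:
  fixes S :: "real set"
  assumes "compact S" "S \<subseteq> {a..b}" "\<delta> > 0"
  shows "\<exists>p. real_polynomial_function p \<and> (LINT t:{a..b}|lborel. \<bar>indicator S t - p t\<bar>) \<le> \<delta>"
proof (cases "S = {}")
  case True
  then show ?thesis
    using \<open>\<delta> > 0\<close> by (intro exI[of _ "\<lambda>_. 0"]) auto
next
  case False
  define h where "h n t = 1 / (1 + real n * infdist t S)" for n t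
  have pos: "1 + real n * infdist t S > 0" for n t
    by (simp add: add_pos_nonneg infdist_nonneg)
  have h_cont: "continuous_on X (h n)" for X n
    unfolding h_def using pos[of n] by (intro continuous_intros) (metis less_irrefl)
  have h_bounds: "0 \<le> h n t" "h n t \<le> 1" for n t
    unfolding h_def using infdist_nonneg[of t S] by (auto simp: field_simps add_pos_nonneg)
  have h_meas: "h n \<in> borel_measurable borel" for n
    by (intro borel_measurable_continuous_onI h_cont)
  have S_meas: "S \<in> sets borel"
    using \<open>compact S\<close> by (simp add: borel_compact)
  have diff_le: "\<bar>indicator S t - h n t\<bar> \<le> 1" for n t
    using h_bounds[of n t] by (auto simp: indicator_def)
  have "(\<lambda>n. LINT t|lborel. indicator {a..b} t *\<^sub>R \<bar>indicator S t - h n t\<bar>) \<longlonglongrightarrow> (LINT t|(lborel :: real measure). (0::real))"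
  proof (rule integral_dominated_convergence[where w = "indicator {a..b}"])
    show "(\<lambda>t. indicator {a..b} t *\<^sub>R \<bar>indicator S t - h n t\<bar>) \<in> borel_measurable lborel" for n
      using h_meas[of n] S_meas by measurable
    show "AE t in lborel. norm (indicator {a..b} t *\<^sub>R \<bar>indicator S t - h n t\<bar>) \<le> indicator {a..b} t" for n
      using diff_le[of _ n] by (auto simp: indicator_def)
    have "(\<lambda>n. h n t) \<longlonglongrightarrow> indicator S t" for t
    proof (cases "t \<in> S")
      case True
      then show ?thesis by (simp add: h_def)
    next
      case False
      then have "infdist t S > 0"
        using \<open>compact S\<close> \<open>S \<noteq> {}\<close> by (metis compact_imp_closed infdist_pos_not_in_closed)
      then have "(\<lambda>n. h n t) \<longlonglongrightarrow> 0"
        unfolding h_def by real_asymp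
      then show ?thesis using False by simp
    qed
    then have "(\<lambda>n. indicator S t - h n t) \<longlonglongrightarrow> indicator S t - indicator S t" for t :: real
      by (intro tendsto_diff tendsto_const)
    then have "(\<lambda>n. \<bar>indicator S t - h n t\<bar>) \<longlonglongrightarrow> 0" for t :: real
      by (intro tendsto_rabs_zero) simp
    then show "AE t in lborel. (\<lambda>n. indicator {a..b} t *\<^sub>R \<bar>indicator S t - h n t\<bar>) \<longlonglongrightarrow> 0"
      by (intro AE_I2) (auto simp: indicator_def[of "{a..b}"])
  qed (simp_all add: integrable_indicator_iff emeasure_lborel_Icc_eq)
  then have "(\<lambda>n. LINT t:{a..b}|lborel. \<bar>indicator S t - h n t\<bar>) \<longlonglongrightarrow> 0"
    by (simp add: set_lebesgue_integral_def)
  from order_tendstoD(2)[OF this, of "\<delta> / 2"] \<open>\<delta> > 0\<close> obtain n where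
    n: "(LINT t:{a..b}|lborel. \<bar>indicator S t - h n t\<bar>) < \<delta> / 2"
    by (auto simp: eventually_sequentially)
  have "a \<le> b" using False assms(2) by auto
  \<comment> \<open>The added 1 avoids a zero denominator when a = b; still (b - a) \<eta> \<le>
    \<delta>/2.\<close>
  define \<eta> where "\<eta> = \<delta> / (2 * (b - a + 1))"
  have "\<eta> > 0" using \<open>\<delta> > 0\<close> \<open>a \<le> b\<close> by (simp add: \<eta>_def)
  obtain p where p: "real_polynomial_function p" "\<And>t. t \<in> {a..b} \<Longrightarrow> \<bar>h n t - p t\<bar> < \<eta>"
    using Stone_Weierstrass_real_polynomial_function[OF compact_Icc h_cont \<open>\<eta> > 0\<close>] by blast
  have p_cont: "continuous_on X p" for X
    using p(1) by (simp add: continuous_on_polymonial_function real_polynomial_function_eq)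
  have int_S: "set_integrable lborel {a..b} (\<lambda>t. indicator S t :: real)"
  proof -
    have "integrable lborel (indicator S :: real \<Rightarrow> real)"
      using S_meas emeasure_bounded_finite[OF compact_imp_bounded[OF \<open>compact S\<close>]]
      by (simp add: integrable_indicator_iff)
    moreover have "(\<lambda>t. indicator {a..b} t *\<^sub>R indicator S t) = (indicator S :: real \<Rightarrow> real)"
      using assms(2) by (auto simp: indicator_def fun_eq_iff)
    ultimately show ?thesis
      by (simp add: set_integrable_def)
  qed
  have int: "set_integrable lborel {a..b} h'" if "continuous_on {a..b} h'" for h' :: "real \<Rightarrow> real"
    using that by (rule borel_integrable_atLeastAtMost')
  have i1: "set_integrable lborel {a..b} (\<lambda>t. \<bar>indicator S t - h n t\<bar>)"
    by (intro set_integrable_abs set_integral_diff int_S int h_cont)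
  have "(LINT t:{a..b}|lborel. \<bar>indicator S t - p t\<bar>) \<le> (LINT t:{a..b}|lborel. \<bar>indicator S t - h n t\<bar> + \<eta>)"
  proof (intro set_integral_mono)
    show "set_integrable lborel {a..b} (\<lambda>t. \<bar>indicator S t - p t\<bar>)"
      by (intro set_integrable_abs set_integral_diff int_S int p_cont)
    show "set_integrable lborel {a..b} (\<lambda>t. \<bar>indicator S t - h n t\<bar> + \<eta>)"
      by (intro set_integral_add i1 int continuous_intros)
    show "\<bar>indicator S t - p t\<bar> \<le> \<bar>indicator S t - h n t\<bar> + \<eta>" if "t \<in> {a..b}" for t
      using p(2)[OF that] by linarith
  qed
  also have "\<dots> = (LINT t:{a..b}|lborel. \<bar>indicator S t - h n t\<bar>) + (LINT t:{a..b}|lborel. \<eta>)"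
    by (intro set_integral_add i1 int continuous_intros)
  also have "(LINT t:{a..b}|lborel. \<eta>) = (b - a) * \<eta>"
    using \<open>a \<le> b\<close> by (simp add: set_integral_const)
  also have "(b - a) * \<eta> \<le> \<delta> / 2"
    using \<open>a \<le> b\<close> \<open>\<delta> > 0\<close> by (simp add: \<eta>_def field_simps)
  finally show ?thesis
    using n p(1) by (intro exI[of _ p]) auto
qed

lemma set_integrable_continuous_compact:
  fixes f :: "real \<Rightarrow> 'a::{banach, second_countable_topology}"
  assumes "compact S" "continuous_on S f"
  shows "set_integrable lborel S f"
  using borel_integrable_compact[OF assms] unfolding set_integrable_def by (simp add: indicator_scaleR_eq_if)

text \<open>\<open>cis\<close> has modulus 1, so exchanging the indicator of S for the polynomial
  costs at most their L^1 distance, whatever A and B are. Half of \<delta> pays for this, half for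
  the smooth integral.\<close>

lemma oscillatory_integral_compact:
  fixes S :: "real set"
  assumes S: "compact S" and "\<delta> > 0"
  shows "\<exists>M>0. \<forall>A B. A\<^sup>2 + B\<^sup>2 \<ge> M\<^sup>2 \<longrightarrow>
    norm (LINT t:S|lborel. cis (A * cos t + B * sin t)) \<le> \<delta>"
proof -
  obtain c where c: "\<And>t. t \<in> S \<Longrightarrow> \<bar>t\<bar> \<le> c"
    using compact_imp_bounded[OF S] by (auto simp: bounded_iff)
  \<comment> \<open>The absolute value matters for empty S, where c may be negative.\<close>
  define b where "b = \<bar>c\<bar>"
  have Sb: "S \<subseteq> {- b..b}" and "- b \<le> b" using c by (force simp: b_def)+
  have d: "\<delta> / 2 > 0" using \<open>\<delta> > 0\<close> by simp
  obtain p where p: "real_polynomial_function p"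
    and p_le: "(LINT t:{- b..b}|lborel. \<bar>indicator S t - p t\<bar>) \<le> \<delta> / 2"
    using indicator_L1_approx_polynomial[OF S Sb d] by blast
  obtain p' where p': "real_polynomial_function p'" "\<And>t. (p has_real_derivative p' t) (at t)"
    using has_real_derivative_polynomial_function[OF p] by blast
  have cont: "continuous_on X p" "continuous_on X p'" for X
    using p p'(1) by (simp_all add: continuous_on_polymonial_function real_polynomial_function_eq)
  obtain M where "M > 0" and M: "\<And>A B. A\<^sup>2 + B\<^sup>2 \<ge> M\<^sup>2 \<Longrightarrow>
      norm (LINT t:{- b..b}|lborel. p t *\<^sub>R cis (A * cos t + B * sin t)) \<le> \<delta> / 2"
    using oscillatory_integral_smooth[OF \<open>- b \<le> b\<close> d p'(2) cont(2)] by blast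
  have "norm (LINT t:S|lborel. cis (A * cos t + B * sin t)) \<le> \<delta>" if AB: "A\<^sup>2 + B\<^sup>2 \<ge> M\<^sup>2" for A B
  proof -
    define e where "e t = cis (A * cos t + B * sin t)" for t
    have cont_e: "continuous_on X e" for X
      unfolding e_def by (intro continuous_intros)
    have ind: "indicator {- b..b} t *\<^sub>R indicator S t *\<^sub>R x = indicator S t *\<^sub>R x" for t and x :: "'b::real_vector"
      using Sb by (auto simp: indicator_def)
    have int_ind: "set_integrable lborel {- b..b} (\<lambda>t. indicator S t *\<^sub>R e t)"
      using set_integrable_continuous_compact[OF S cont_e] by (simp add: set_integrable_def ind del: scaleR_scaleR)
    have int_p: "set_integrable lborel {- b..b} (\<lambda>t. p t *\<^sub>R e t)"
      by (intro set_integrable_continuous_compact compact_Icc continuous_intros cont cont_e)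
    have "(LINT t:S|lborel. e t) = (LINT t:{- b..b}|lborel. indicator S t *\<^sub>R e t)"
      by (simp add: set_lebesgue_integral_def ind del: scaleR_scaleR)
    also have "\<dots> = (LINT t:{- b..b}|lborel. indicator S t *\<^sub>R e t - p t *\<^sub>R e t)
        + (LINT t:{- b..b}|lborel. p t *\<^sub>R e t)"
      using int_ind int_p by simp
    finally have "norm (LINT t:S|lborel. e t)
        \<le> norm (LINT t:{- b..b}|lborel. indicator S t *\<^sub>R e t - p t *\<^sub>R e t)
          + norm (LINT t:{- b..b}|lborel. p t *\<^sub>R e t)"
      by (simp only: norm_triangle_ineq)
    also have "norm (LINT t:{- b..b}|lborel. indicator S t *\<^sub>R e t - p t *\<^sub>R e t)
        \<le> (LINT t:{- b..b}|lborel. norm (indicator S t *\<^sub>R e t - p t *\<^sub>R e t))"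
      by (intro set_integral_norm_bound set_integral_diff int_ind int_p)
    also have "\<dots> = (LINT t:{- b..b}|lborel. \<bar>indicator S t - p t\<bar>)"
      by (simp add: e_def flip: scaleR_diff_left)
    also note p_le
    also have "norm (LINT t:{- b..b}|lborel. p t *\<^sub>R e t) \<le> \<delta> / 2"
      using M[OF AB] by (simp add: e_def)
    finally show ?thesis by (simp add: e_def)
  qed
  with \<open>M > 0\<close> show ?thesis by blast
qed

section \<open>Averages of characters and of the test function over rotations\<close>

lemma inner_rotation_minus:
  fixes w x :: "real^2"
  shows "w \<bullet> (rotation (- t) *v x) = (w \<bullet> x) * cos t + (w $ 1 * x $ 2 - w $ 2 * x $ 1) * sin t"
  by (simp add: rotation_def matrix_vector_mult_def inner_vec_def sum_2 algebra_simps)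

lemma rotation_rotation_minus: "rotation t *v (rotation (- t) *v x) = x"
proof -
  have *: "cos t * (cos t * a + sin t * b) - sin t * (cos t * b - sin t * a) = a"
    "sin t * (cos t * a + sin t * b) + cos t * (cos t * b - sin t * a) = b" for a b
    using sin_cos_squared_add[of t] by algebra+
  show ?thesis
    using * by (simp add: vec_eq_iff forall_2 rotation_def matrix_vector_mult_def sum_2)
qed

text \<open>The phase has coefficients A = w . x and B = det(w, x). Lagrange's identity gives A^2 +
  B^2 = |w|^2 |x|^2, so the uniform decay in (A, B) becomes decay in |x| alone.\<close>

lemma tendsto_exponential_integral:
  fixes w :: "real^2"
  assumes S: "compact S" and "w \<noteq> 0"
  shows "((\<lambda>x. LINT t:S|lborel. cis (w \<bullet> (rotation (- t) *v x))) \<longlongrightarrow> 0) at_infinity"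
  unfolding Lim_at_infinity
proof (intro allI impI)
  fix e :: real assume "e > 0"
  then obtain M where "M > 0" and M: "\<And>A B. A\<^sup>2 + B\<^sup>2 \<ge> M\<^sup>2 \<Longrightarrow>
    norm (LINT t:S|lborel. cis (A * cos t + B * sin t)) \<le> e / 2"
    using oscillatory_integral_compact[OF S, of "e / 2"] by auto
  have "dist (LINT t:S|lborel. cis (w \<bullet> (rotation (- t) *v x))) 0 < e" if "M / norm w \<le> norm x" for x :: "real^2"
  proof -
    have "M \<le> norm w * norm x"
      using that \<open>w \<noteq> 0\<close> by (simp add: field_simps)
    then have "M\<^sup>2 \<le> (norm w * norm x)\<^sup>2"
      using \<open>M > 0\<close> by (intro power_mono) auto
    also have "\<dots> = (w \<bullet> x)\<^sup>2 + (w $ 1 * x $ 2 - w $ 2 * x $ 1)\<^sup>2"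
      unfolding power_mult_distrib power2_norm_eq_inner inner_vec_def sum_2 inner_real_def by algebra
    finally show ?thesis
      using M[of "w \<bullet> x" "w $ 1 * x $ 2 - w $ 2 * x $ 1"] \<open>e > 0\<close>
      by (simp add: inner_rotation_minus)
  qed
  then show "\<exists>b. \<forall>x. b \<le> norm x \<longrightarrow> dist (LINT t:S|lborel. cis (w \<bullet> (rotation (- t) *v x))) 0 < e"
    by blast
qed

text \<open>Binomial expansion of ((cis x + cis (-x)) / 2)^(2N). All frequencies are even, so at x =
  pi a every term has period 1 in a; the constant term k = N carries the mean.\<close>

lemma cos_even_power_eq_sum_cis:
  "complex_of_real (cos x ^ (2 * N)) =
    (\<Sum>k\<le>2 * N. of_real (real (2 * N choose k) / 4 ^ N) * cis (2 * (real k - real N) * x))"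
proof -
  have "complex_of_real (cos x ^ (2 * N)) = ((cis x + cis (- x)) / 2) ^ (2 * N)"
    by (simp add: complex_eq_iff flip: of_real_power)
  also have "\<dots> = (\<Sum>k\<le>2 * N. of_nat (2 * N choose k) * cis x ^ k * cis (- x) ^ (2 * N - k)) / 4 ^ N"
    unfolding power_divide binomial_ring by (simp add: power_mult)
  also have "\<dots> = (\<Sum>k\<le>2 * N. of_real (real (2 * N choose k) / 4 ^ N) * cis (2 * (real k - real N) * x))"
    unfolding sum_divide_distrib
  proof (rule sum.cong)
    fix k assume "k \<in> {..2 * N}"
    then have "cis x ^ k * cis (- x) ^ (2 * N - k) = cis (2 * (real k - real N) * x)"
      unfolding Complex.DeMoivre cis_mult
      by (intro arg_cong[where f = cis]) (simp add: of_nat_diff algebra_simps)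
    then show "of_nat (2 * N choose k) * cis x ^ k * cis (- x) ^ (2 * N - k) / 4 ^ N
        = of_real (real (2 * N choose k) / 4 ^ N) * cis (2 * (real k - real N) * x)"
      by (simp add: mult.assoc)
  qed simp
  finally show ?thesis .
qed

text \<open>Multiplying the two expansions gives finitely many characters with frequency vectors
  \<open>z i\<close>. Independence of v and w makes all of them nonzero except at i = (N, N), so in
  the limit only the product of the two central coefficients survives.\<close>

lemma tendsto_test_function_integral:
  fixes v w :: "real^2"
  assumes S: "compact S" and vw: "\<And>a b. a *\<^sub>R v + b *\<^sub>R w = 0 \<Longrightarrow> a = 0 \<and> b = 0"
  shows "((\<lambda>x. LINT t:S|lborel. cos (v \<bullet> (rotation (- t) *v x)) ^ (2 * N) * cos (w \<bullet> (rotation (- t) *v x)) ^ (2 * N))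
    \<longlongrightarrow> (real (2 * N choose N) / 4 ^ N)\<^sup>2 * measure lborel S) at_infinity"
proof -
  define J where "J = {..2 * N} \<times> {..2 * N}"
  define c where "c j = real (2 * N choose j) / 4 ^ N" for j
  define z where "z i = (2 * (real (fst i) - real N)) *\<^sub>R v + (2 * (real (snd i) - real N)) *\<^sub>R w" for i
  have z: "z i = 0 \<longleftrightarrow> i = (N, N)" for i
    using vw by (fastforce simp: z_def prod_eq_iff)
  have exp_cont: "continuous_on X (\<lambda>t. cis (y \<bullet> (rotation (- t) *v x)))" for X x and y :: "real^2"
    unfolding inner_rotation_minus by (intro continuous_intros)
  have exp_int: "set_integrable lborel S (\<lambda>t. cis (y \<bullet> (rotation (- t) *v x)))" for x and y :: "real^2"
    by (intro set_integrable_continuous_compact S exp_cont)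
  have expand: "complex_of_real (cos (v \<bullet> y) ^ (2 * N) * cos (w \<bullet> y) ^ (2 * N))
      = (\<Sum>i\<in>J. of_real (c (fst i) * c (snd i)) * cis (z i \<bullet> y))" for y
    unfolding of_real_mult cos_even_power_eq_sum_cis sum_product sum.cartesian_product J_def
    by (intro sum.cong) (auto simp: c_def z_def cis_mult inner_add_left mult_ac)
  have "complex_of_real (LINT t:S|lborel. cos (v \<bullet> (rotation (- t) *v x)) ^ (2 * N) * cos (w \<bullet> (rotation (- t) *v x)) ^ (2 * N))
      = (\<Sum>i\<in>J. of_real (c (fst i) * c (snd i)) * (LINT t:S|lborel. cis (z i \<bullet> (rotation (- t) *v x))))" for x
  proof -
    have "complex_of_real (LINT t:S|lborel. cos (v \<bullet> (rotation (- t) *v x)) ^ (2 * N) * cos (w \<bullet> (rotation (- t) *v x)) ^ (2 * N))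
      = (LINT t:S|lborel. (\<Sum>i\<in>J. of_real (c (fst i) * c (snd i)) * cis (z i \<bullet> (rotation (- t) *v x))))"
      unfolding expand[symmetric] by (simp only: set_integral_complex_of_real)
    also have "\<dots> = (\<Sum>i\<in>J. LINT t:S|lborel. of_real (c (fst i) * c (snd i)) * cis (z i \<bullet> (rotation (- t) *v x)))"
      unfolding set_lebesgue_integral_def scaleR_sum_right
      using set_integrable_mult_right[OF exp_int]
      by (intro Bochner_Integration.integral_sum) (simp add: set_integrable_def)
    finally show ?thesis by simp
  qed
  moreover have "((\<lambda>x. \<Sum>i\<in>J. of_real (c (fst i) * c (snd i)) * (LINT t:S|lborel. cis (z i \<bullet> (rotation (- t) *v x))))
      \<longlongrightarrow> (\<Sum>i\<in>J. of_real (c (fst i) * c (snd i)) * (if i = (N, N) then of_real (measure lborel S) else 0))) at_infinity"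
  proof (intro tendsto_sum tendsto_mult_left)
    fix i
    show "((\<lambda>x. LINT t:S|lborel. cis (z i \<bullet> (rotation (- t) *v x)))
      \<longlongrightarrow> (if i = (N, N) then of_real (measure lborel S) else 0)) at_infinity"
    proof (cases "i = (N, N)")
      case True
      moreover have "S \<in> sets lborel" "emeasure lborel S \<noteq> \<infinity>"
        using S emeasure_bounded_finite[OF compact_imp_bounded[OF S]] by (auto simp: borel_compact)
      then have "(LINT t:S|lborel. (1::complex)) = of_real (measure lborel S)"
        by (subst set_integral_const) (auto simp: scaleR_conv_of_real)
      ultimately show ?thesis using z[of i] by simp
    next
      case False
      then show ?thesis using tendsto_exponential_integral[OF S, of "z i"] z[of i] by simp
    qed
  qed
  moreover have "(\<Sum>i\<in>J. complex_of_real (c (fst i) * c (snd i)) * (if i = (N, N) then of_real (measure lborel S) else 0))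
      = of_real ((c N)\<^sup>2 * measure lborel S)"
    by (simp add: J_def if_distrib power2_eq_square cong: if_cong)
  ultimately show ?thesis
    unfolding c_def by (metis (no_types, lifting) ext tendsto_of_real_iff)
qed

section \<open>Pointwise size and mean of the test function\<close>

text \<open>With d the distance from s to the nearest integer, d \<le> 1/2 and |cos(pi s)| = cos(pi
  d), and cosine decreases on [0, pi/2].\<close>

lemma near_integer_if_cos_squared_large:
  fixes s \<eta> :: real
  assumes "0 \<le> \<eta>" "\<eta> \<le> 1 / 2" "(cos (pi * s))\<^sup>2 > (cos (pi * \<eta>))\<^sup>2"
  shows "\<bar>s - of_int (round s)\<bar> < \<eta>"
proof (rule ccontr)
  define d where "d = \<bar>s - of_int (round s)\<bar>"
  assume "\<not> \<bar>s - of_int (round s)\<bar> < \<eta>"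
  then have "\<eta> \<le> d" by (simp add: d_def)
  have "d \<le> 1 / 2"
    using of_int_round_abs_le[of s] by (simp add: d_def abs_minus_commute)
  have "pi * d \<le> pi / 2" using \<open>d \<le> 1 / 2\<close> by simp
  have "0 \<le> d" by (simp add: d_def)
  have "\<bar>cos (pi * s)\<bar> = \<bar>cos (pi * (s - of_int (round s)))\<bar>"
    by (simp add: right_diff_distrib cos_diff abs_mult cos_npi_int sin_npi_int)
  also have "\<dots> = \<bar>cos (pi * d)\<bar>"
    unfolding d_def by (metis abs_mult abs_of_pos cos_abs_real pi_gt_zero)
  also have "\<dots> = cos (pi * d)"
    using \<open>pi * d \<le> pi / 2\<close> \<open>0 \<le> d\<close> by (intro abs_of_nonneg cos_ge_zero) (auto intro: order_trans[of _ 0])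
  finally have eq: "\<bar>cos (pi * s)\<bar> = cos (pi * d)" .
  have "cos (pi * d) \<le> cos (pi * \<eta>)"
    using \<open>\<eta> \<le> d\<close> assms(1) \<open>pi * d \<le> pi / 2\<close> by (intro cos_monotone_0_pi_le) auto
  then have "\<bar>cos (pi * s)\<bar> \<le> \<bar>cos (pi * \<eta>)\<bar>" using eq by linarith
  with assms(3) show False by (simp add: abs_le_square_iff)
qed

text \<open>The crude bound 4^N / (2N) for the central binomial coefficient leaves 1 / (4 N^2) after
  squaring, and polynomial decay already loses to q^N.\<close>

lemma geometric_less_central_binomial_squared:
  fixes q :: real
  assumes "0 < q" "q < 1"
  obtains N where "q ^ N < (real (2 * N choose N) / 4 ^ N)\<^sup>2"
proof -
  have "(\<lambda>N. 4 * real N ^ 2 * q ^ N) \<longlonglongrightarrow> 0"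
    using assms by real_asymp
  from order_tendstoD(2)[OF this, of 1] have "eventually (\<lambda>N. 4 * real N ^ 2 * q ^ N < 1) sequentially"
    by simp
  with eventually_gt_at_top[of 0] have "eventually (\<lambda>N. N > 0 \<and> 4 * real N ^ 2 * q ^ N < 1) sequentially"
    by eventually_elim simp
  then obtain N where N: "N > 0" "4 * real N ^ 2 * q ^ N < 1"
    by (auto simp: eventually_sequentially)
  have "q ^ N < (1 / (2 * real N))\<^sup>2"
    using N by (simp add: field_simps power2_eq_square)
  also have "\<dots> \<le> (real (2 * N choose N) / 4 ^ N)\<^sup>2"
    using central_binomial_lower_bound[OF N(1)] N(1) by (intro power_mono) (auto simp: field_simps)
  finally show thesis by (rule that)
qed

section \<open>Lattices: independent vectors and detection of nearby lattice points\<close>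

lemma additive_subgroup_int_scale:
  assumes L: "additive_subgroup (L :: 'a::real_vector set)" and "x \<in> L"
  shows "of_int n *\<^sub>R x \<in> L"
proof -
  have nat: "of_nat k *\<^sub>R x \<in> L" for k
    using assms by (induction k) (auto simp: additive_subgroup_def scaleR_add_left)
  show ?thesis
  proof (cases n)
    case (nonneg k)
    then show ?thesis using nat[of k] by simp
  next
    case (neg k)
    then show ?thesis
      using nat[of "Suc k"] L by (auto simp: additive_subgroup_def simp del: of_nat_Suc)
  qed
qed

lemma discrete_subgroup_norm_bound:
  assumes "additive_subgroup (L :: 'a::real_normed_vector set)" "discrete L"
  obtains d where "d > 0" "\<And>x. x \<in> L \<Longrightarrow> norm x < d \<Longrightarrow> x = 0"
proof -
  have "0 \<in> L" using assms by (simp add: additive_subgroup_def)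
  then obtain T where T: "open T" "T \<inter> L = {0}"
    using discreteD[OF assms(2)] unfolding isolated_in_def by blast
  then obtain d where "d > 0" "ball 0 d \<subseteq> T"
    by (metis IntD1 insertI1 open_contains_ball)
  with T that[of d] show thesis by (auto simp: subset_iff)
qed

text \<open>Dirichlet approximation of s makes (q s - p) x an element of L shorter than the gap d
  around 0, hence zero. Without discreteness this fails, as for 1 and sqrt 2 in Z + sqrt(2)
  Z.\<close>

lemma discrete_subgroup_collinear_dependent:
  assumes L: "additive_subgroup (L :: 'a::real_normed_vector set)" "discrete L"
    and x: "x \<in> L" "x \<noteq> 0" and y: "s *\<^sub>R x \<in> L"
  shows "\<exists>m n :: int. n \<noteq> 0 \<and> of_int n *\<^sub>R (s *\<^sub>R x) = of_int m *\<^sub>R x"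
proof -
  obtain d where d: "d > 0" "\<And>z. z \<in> L \<Longrightarrow> norm z < d \<Longrightarrow> z = 0"
    using discrete_subgroup_norm_bound[OF L] by blast
  \<comment> \<open>An error |q s - p| < 1/N then gives a vector of norm below d.\<close>
  obtain N :: nat where N: "N > 0" "1 / N < d / norm x"
    using d(1) x(2) nat_approx_posE[of "d / norm x"]
    by (metis divide_pos_pos zero_less_Suc zero_less_norm_iff)
  obtain q p where q: "0 < q" "q \<le> int N" and qp: "\<bar>of_int q * s - of_int p\<bar> < 1 / N"
    using Dirichlet_approx[OF N(1)] .
  define z where "z = of_int q *\<^sub>R (s *\<^sub>R x) + of_int (- p) *\<^sub>R x"
  have "z \<in> L"
    unfolding z_def using L(1) additive_subgroup_int_scale[OF L(1)] x y
    by (metis additive_subgroup_def)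
  moreover have "z = (of_int q * s - of_int p) *\<^sub>R x"
    by (simp add: z_def scaleR_diff_left)
  then have "norm z = \<bar>of_int q * s - of_int p\<bar> * norm x"
    by simp
  then have "norm z < d / norm x * norm x"
    using qp N(2) x(2) by (metis less_trans mult_strict_right_mono zero_less_norm_iff)
  then have "norm z < d"
    using x(2) by simp
  ultimately have "z = 0" using d by blast
  then show ?thesis
    using q(1) unfolding z_def by (intro exI[of _ p] exI[of _ q]) auto
qed

text \<open>The rank supplies independence over the integers only; discreteness upgrades it to
  independence over the reals. The two vectors may span a proper sublattice, which is harmless:
  lattice points found there still lie in \<open>\<Lambda>\<close>.\<close>

lemma lattice_contains_basis:
  assumes "is_lattice \<Lambda>"
  obtains u v where "u \<in> \<Lambda>" "v \<in> \<Lambda>" "u $ 1 * v $ 2 - u $ 2 * v $ 1 \<noteq> 0"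
proof -
  have L: "additive_subgroup \<Lambda>" "discrete \<Lambda>" and "has_rank \<Lambda> 2"
    using assms by (auto simp: is_lattice_def)
  then obtain B where B: "B \<subseteq> \<Lambda>" "int_independent B" "card B = 2"
    by (auto simp: has_rank_def)
  then obtain u v where uv: "B = {u, v}" "u \<noteq> v"
    by (auto simp: card_2_iff)
  have ind: "m = 0 \<and> n = 0" if "of_int m *\<^sub>R u + of_int n *\<^sub>R v = 0" for m n :: int
  proof (rule ccontr)
    assume "\<not> (m = 0 \<and> n = 0)"
    \<comment> \<open>The vanishing combination with coefficients m at u and n at v witnesses
      dependence.\<close>
    then have "module.dependent int_scale B"
      unfolding module.dependent_finite[OF module_int_scale, of B, unfolded uv(1), simplified]
        uv(1)
      using uv(2) that by (intro exI[of _ "\<lambda>x. if x = u then m else n"]) auto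
    then show False using B(2) by (simp add: int_independent_def)
  qed
  have "u \<noteq> 0" using ind[of 1 0] by auto
  have "u $ 1 * v $ 2 - u $ 2 * v $ 1 \<noteq> 0"
  proof
    assume det: "u $ 1 * v $ 2 - u $ 2 * v $ 1 = 0"
    have "\<exists>s. v = s *\<^sub>R u"
    proof (cases "u $ 1 = 0")
      case True
      then have "u $ 2 \<noteq> 0" using \<open>u \<noteq> 0\<close> by (auto simp: vec_eq_iff forall_2)
      with True det show ?thesis
        by (intro exI[of _ "v $ 2 / u $ 2"]) (auto simp: vec_eq_iff forall_2)
    next
      case False
      with det show ?thesis
        by (intro exI[of _ "v $ 1 / u $ 1"]) (auto simp: vec_eq_iff forall_2 field_simps)
    qed
    then obtain s where s: "v = s *\<^sub>R u" by blast
    then obtain m n :: int where "n \<noteq> 0" "of_int n *\<^sub>R v = of_int m *\<^sub>R u"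
      using discrete_subgroup_collinear_dependent[OF L, of u s] B(1) uv(1) \<open>u \<noteq> 0\<close> by auto
    then show False using ind[of "- m" n] by simp
  qed
  with that B(1) uv(1) show thesis by auto
qed

text \<open>Both squared cosines are at most 1, so a product of N-th powers above q^N forces each of
  them above q, and then both coordinates of y lie near integers. It is essential that q depends on
  the lattice vectors and \<epsilon> but not on N.\<close>

lemma test_function_detects_fattened:
  assumes L: "additive_subgroup \<Lambda>" and uv: "u \<in> \<Lambda>" "v \<in> \<Lambda>"
    and det: "u $ 1 * v $ 2 - u $ 2 * v $ 1 \<noteq> 0" and "\<epsilon> > 0"
  obtains v' w' q where "\<And>a b. a *\<^sub>R v' + b *\<^sub>R w' = 0 \<Longrightarrow> a = 0 \<and> b = 0"
    and "0 < q" "q < 1"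
    and "\<And>y N. q ^ N < cos (v' \<bullet> y) ^ (2 * N) * cos (w' \<bullet> y) ^ (2 * N) \<Longrightarrow> y \<in> fattened \<Lambda> \<epsilon>"
proof -
  define D where "D = u $ 1 * v $ 2 - u $ 2 * v $ 1"
  have "D \<noteq> 0" using det by (simp add: D_def)
  \<comment> \<open>\<pi> times the dual basis of u, v\<close>
  define v' :: "real^2" where "v' = (pi / D) *\<^sub>R vector [v $ 2, - v $ 1]"
  define w' :: "real^2" where "w' = (pi / D) *\<^sub>R vector [- u $ 2, u $ 1]"
  \<comment> \<open>The bound 1/4 keeps cos(pi \<eta>), hence q, positive. The other bound makes
    rounding both coordinates move y by less than \<epsilon>.\<close>
  define \<eta> where "\<eta> = min (1 / 4) (\<epsilon> / (norm u + norm v))"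
  define q where "q = (cos (pi * \<eta>))\<^sup>2"
  have "u \<noteq> 0" using det by auto
  then have nuv: "norm u > 0" "norm u + norm v > 0" by (simp_all add: add_pos_nonneg)
  have \<eta>: "0 < \<eta>" "\<eta> \<le> 1 / 4" "\<eta> * (norm u + norm v) \<le> \<epsilon>"
  proof -
    show "0 < \<eta>" using \<open>\<epsilon> > 0\<close> nuv by (simp add: \<eta>_def)
    show "\<eta> \<le> 1 / 4" unfolding \<eta>_def by (rule min.cobounded1)
    have "\<eta> * (norm u + norm v) \<le> \<epsilon> / (norm u + norm v) * (norm u + norm v)"
      using nuv by (intro mult_right_mono) (auto simp: \<eta>_def)
    then show "\<eta> * (norm u + norm v) \<le> \<epsilon>"
      using nuv(2) by simp
  qed
  have "pi * \<eta> < pi / 2" using \<eta>(2) by simp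
  then have cos_eta: "0 < cos (pi * \<eta>)" "cos (pi * \<eta>) < 1"
    using \<eta>(1) cos_monotone_0_pi[of 0 "pi * \<eta>"] by (auto intro!: cos_gt_zero)
  then have q: "0 < q" "q < 1"
    by (simp_all add: q_def power_less_one_iff)
  have indep: "a = 0 \<and> b = 0" if "a *\<^sub>R v' + b *\<^sub>R w' = 0" for a b
  proof -
    have "pi / D * (a * v $ 2 - b * u $ 2) = 0" "pi / D * (b * u $ 1 - a * v $ 1) = 0"
      using arg_cong[OF that, of "\<lambda>x. x $ 1"] arg_cong[OF that, of "\<lambda>x. x $ 2"]
      by (simp_all add: v'_def w'_def algebra_simps)
    then have "a * v $ 2 - b * u $ 2 = 0" "b * u $ 1 - a * v $ 1 = 0"
      using \<open>D \<noteq> 0\<close> by simp_all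
    then have "a * D = 0" "b * D = 0"
      unfolding D_def by algebra+
    then show ?thesis using \<open>D \<noteq> 0\<close> by simp
  qed
  have "y \<in> fattened \<Lambda> \<epsilon>"
    if y: "q ^ N < cos (v' \<bullet> y) ^ (2 * N) * cos (w' \<bullet> y) ^ (2 * N)" for y :: "real^2" and N
  proof -
    \<comment> \<open>Cramer's rule for the coordinates of y in the basis u, v.\<close>
    define a where "a = (y $ 1 * v $ 2 - y $ 2 * v $ 1) / D"
    define b where "b = (u $ 1 * y $ 2 - u $ 2 * y $ 1) / D"
    have ab: "v' \<bullet> y = pi * a" "w' \<bullet> y = pi * b"
      by (simp_all add: v'_def w'_def a_def b_def inner_vec_def sum_2 algebra_simps diff_divide_distrib)
    have aD: "a * D = y $ 1 * v $ 2 - y $ 2 * v $ 1" and bD: "b * D = u $ 1 * y $ 2 - u $ 2 * y $ 1"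
      using \<open>D \<noteq> 0\<close> by (simp_all add: a_def b_def)
    have "y $ 1 * D = (a * u $ 1 + b * v $ 1) * D" "y $ 2 * D = (a * u $ 2 + b * v $ 2) * D"
      using aD bD D_def by algebra+
    then have y_eq: "y = a *\<^sub>R u + b *\<^sub>R v"
      using \<open>D \<noteq> 0\<close> by (simp add: vec_eq_iff forall_2)
    define X where "X = (cos (pi * a))\<^sup>2"
    define Y where "Y = (cos (pi * b))\<^sup>2"
    have XY: "0 \<le> X" "X \<le> 1" "0 \<le> Y" "Y \<le> 1"
      by (simp_all add: X_def Y_def abs_square_le_1)
    have lt: "q ^ N < X ^ N * Y ^ N"
      using y by (simp add: X_def Y_def ab power_mult)
    have "q < X"
    proof (rule ccontr)
      assume "\<not> q < X"
      then have "X ^ N * Y ^ N \<le> q ^ N * 1"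
        using XY by (intro mult_mono power_mono power_le_one) auto
      with lt show False by simp
    qed
    moreover have "q < Y"
    proof (rule ccontr)
      assume "\<not> q < Y"
      then have "X ^ N * Y ^ N \<le> 1 * q ^ N"
        using XY by (intro mult_mono power_mono power_le_one) auto
      with lt show False by simp
    qed
    ultimately have near: "\<bar>a - of_int (round a)\<bar> < \<eta>" "\<bar>b - of_int (round b)\<bar> < \<eta>"
      using \<eta> by (auto intro!: near_integer_if_cos_squared_large simp: q_def X_def Y_def)
    define l where "l = of_int (round a) *\<^sub>R u + of_int (round b) *\<^sub>R v"
    have "l \<in> \<Lambda>"
      unfolding l_def using L additive_subgroup_int_scale[OF L] uv
      by (simp add: additive_subgroup_def)
    have "y - l = (a - of_int (round a)) *\<^sub>R u + (b - of_int (round b)) *\<^sub>R v"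
      by (simp add: y_eq l_def algebra_simps)
    then have "norm (y - l) \<le> \<bar>a - of_int (round a)\<bar> * norm u + \<bar>b - of_int (round b)\<bar> * norm v"
      by (metis norm_scaleR norm_triangle_ineq)
    \<comment> \<open>Strictness, required by the open ball, comes from the first summand, where
      norm u > 0.\<close>
    also have "\<dots> < \<eta> * norm u + \<eta> * norm v"
      using near nuv by (intro add_less_le_mono mult_strict_right_mono mult_right_mono) auto
    also have "\<dots> \<le> \<epsilon>" using \<eta>(3) by (simp add: distrib_left)
    finally have "y - l \<in> ball 0 \<epsilon>" by simp
    with \<open>l \<in> \<Lambda>\<close> show ?thesis
      unfolding fattened_def by (force intro: exI[of _ l] exI[of _ "y - l"])
  qed
  then show thesis using that indep q by blast
qed

section \<open>Arc length and the conclusion\<close>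

lemma continuous_on_circle_point: "continuous_on X circle_point"
proof -
  have eq: "circle_point = (\<lambda>t. \<chi> i. if i = 1 then cos t else sin t)"
    by (auto simp: circle_point_def fun_eq_iff vec_eq_iff forall_2)
  have "continuous_on X (\<lambda>t. if i = 1 then cos t else sin t)" for i :: 2
    by (cases "i = 1") (auto intro: continuous_intros)
  from ssubst[OF eq, of "continuous_on X", OF continuous_on_vec_lambda, OF this]
  show ?thesis .
qed

text \<open>Passing from the half-open to the closed parameter interval makes the angle set of a
  closed \<open>\<Theta>\<close> compact; an inequality in this direction carries positivity
  over.\<close>

lemma arc_length_measure_le:
  assumes "\<Theta> \<in> sets borel"
  shows "emeasure arc_length_measure \<Theta> \<le> emeasure lborel {t \<in> {0..2 * pi}. circle_point t \<in> \<Theta>}"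
proof -
  have meas: "circle_point \<in> borel_measurable borel"
    by (intro borel_measurable_continuous_onI continuous_on_circle_point)
  then have meas': "circle_point \<in> measurable (restrict_space lborel {0..<2 * pi}) borel"
    by (simp add: measurable_restrict_space1)
  have "emeasure arc_length_measure \<Theta>
      = emeasure (restrict_space lborel {0..<2 * pi}) (circle_point -` \<Theta> \<inter> {0..<2 * pi})"
    unfolding arc_length_measure_def using assms meas'
    by (subst emeasure_distr) (auto simp: space_restrict_space)
  also have "\<dots> = emeasure lborel (circle_point -` \<Theta> \<inter> {0..<2 * pi})"
    by (intro emeasure_restrict_space) auto
  also have "\<dots> \<le> emeasure lborel {t \<in> {0..2 * pi}. circle_point t \<in> \<Theta>}"
  proof (rule emeasure_mono)
    have "{t \<in> {0..2 * pi}. circle_point t \<in> \<Theta>} = circle_point -` \<Theta> \<inter> {0..2 * pi}"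
      by auto
    also have "\<dots> \<in> sets borel"
      using measurable_sets[OF meas assms] by (intro sets.Int) auto
    finally show "{t \<in> {0..2 * pi}. circle_point t \<in> \<Theta>} \<in> sets lborel"
      by simp
  qed auto
  finally show ?thesis .
qed

theorem corollary6:
  fixes \<Theta> :: "(real^2) set"
  assumes "\<Theta> \<subseteq> unit_circle"
    and "closed \<Theta>"
    and "emeasure arc_length_measure \<Theta> > 0"
  shows "good \<Theta>"
  unfolding good_def
proof (intro allI impI)
  fix \<Lambda> :: "(real^2) set" and \<epsilon> :: real
  assume \<Lambda>: "is_lattice \<Lambda>" and "\<epsilon> > 0"
  define S where "S = {t \<in> {0..2 * pi}. circle_point t \<in> \<Theta>}"
  have "S = {0..2 * pi} \<inter> circle_point -` \<Theta>" by (auto simp: S_def)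
  moreover have "closed (circle_point -` \<Theta>)"
    using \<open>closed \<Theta>\<close> continuous_on_circle_point[of UNIV]
    by (simp add: closed_vimage)
  ultimately have S: "compact S"
    by (simp add: compact_Int_closed)
  have fin: "emeasure lborel S < \<infinity>"
    by (intro emeasure_bounded_finite compact_imp_bounded S)
  have "emeasure lborel S > 0"
    using arc_length_measure_le[of \<Theta>] assms(2,3) unfolding S_def by auto
  with fin have S_pos: "measure lborel S > 0"
    by (simp add: measure_def enn2real_positive_iff)
  obtain u v where uv: "u \<in> \<Lambda>" "v \<in> \<Lambda>" "u $ 1 * v $ 2 - u $ 2 * v $ 1 \<noteq> 0"
    using lattice_contains_basis[OF \<Lambda>] by blast
  have L: "additive_subgroup \<Lambda>" using \<Lambda> by (simp add: is_lattice_def)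
  obtain v' w' q where indep: "\<And>a b. a *\<^sub>R v' + b *\<^sub>R w' = 0 \<Longrightarrow> a = 0 \<and> b = 0"
    and q: "0 < q" "q < 1"
    and detect: "\<And>y N. q ^ N < cos (v' \<bullet> y) ^ (2 * N) * cos (w' \<bullet> y) ^ (2 * N) \<Longrightarrow> y \<in> fattened \<Lambda> \<epsilon>"
    using test_function_detects_fattened[OF L uv \<open>\<epsilon> > 0\<close>] by blast
  obtain N where N: "q ^ N < (real (2 * N choose N) / 4 ^ N)\<^sup>2"
    using geometric_less_central_binomial_squared[OF q] by blast
  define F where "F x t = cos (v' \<bullet> (rotation (- t) *v x)) ^ (2 * N) * cos (w' \<bullet> (rotation (- t) *v x)) ^ (2 * N)"
    for x t
  have "((\<lambda>x. LINT t:S|lborel. F x t) \<longlongrightarrow> (real (2 * N choose N) / 4 ^ N)\<^sup>2 * measure lborel S) at_infinity"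
    unfolding F_def by (intro tendsto_test_function_integral S indep)
  then have "eventually (\<lambda>x. (LINT t:S|lborel. F x t) > q ^ N * measure lborel S) at_infinity"
    using N S_pos by (intro order_tendstoD(1)) auto
  then obtain R where R: "\<And>x. norm x \<ge> R \<Longrightarrow> (LINT t:S|lborel. F x t) > q ^ N * measure lborel S"
    by (auto simp: eventually_at_infinity)
  have "x \<in> rotate_set \<Theta> (fattened \<Lambda> \<epsilon>)" if "norm x \<ge> R" for x
  proof -
    \<comment> \<open>A function bounded by q^N on S cannot have an integral above q^N times the
      measure of S.\<close>
    have "\<exists>t\<in>S. q ^ N < F x t"
    proof (rule ccontr)
      assume "\<not> (\<exists>t\<in>S. q ^ N < F x t)"
      then have le: "F x t \<le> q ^ N" if "t \<in> S" for t using that by force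
      have "continuous_on S (F x)"
        unfolding F_def inner_rotation_minus by (intro continuous_intros)
      then have "(LINT t:S|lborel. F x t) \<le> (LINT t:S|lborel. q ^ N)"
        by (intro set_integral_mono set_integrable_continuous_compact S le continuous_intros)
      also have "\<dots> = q ^ N * measure lborel S"
        using S fin by (subst set_integral_const) (auto simp: borel_compact)
      finally show False using R[OF \<open>norm x \<ge> R\<close>] by simp
    qed
    then obtain t where "t \<in> S" "q ^ N < F x t" by blast
    then have "rotation (- t) *v x \<in> fattened \<Lambda> \<epsilon>" "circle_point t \<in> \<Theta>"
      using detect by (auto simp: F_def S_def)
    then show ?thesis
      unfolding rotate_set_def using rotation_rotation_minus[of t x] by force
  qed
  \<comment> \<open>The maximum with 1 secures a positive radius, since R may be zero or
    negative.\<close>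
  then have "- ball 0 (max R 1) \<subseteq> rotate_set \<Theta> (fattened \<Lambda> \<epsilon>)"
    by auto
  then show "good_for \<Lambda> \<epsilon> \<Theta>"
    unfolding good_for_def by (meson less_max_iff_disj zero_less_one)
qed

end
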